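(* Let $\lambda,\mu\in\mathbb R$ be constants with $\mu\neq 0$, let $V=\sum_{k=1}^3V^kE_k$ be a smooth vector field on $I$, and suppose that $(I,\tilde g,V,\lambda,\mu)$ is an $\eta$-Ricci soliton with $\eta=dx^3$. If $f_1=f_1(x^1)$ depends only on $x^1$ and $f_2=f_2(x^2)$ depends only on $x^2$, then there exist constants $c_1,\dots,c_6\in\mathbb R$ such that $$\begin{aligned} V^1(x^1,x^2,x^3)&=-\lambda F_1(x^1)+c_1F_2(x^2)+c_2x^3+c_3,\\ V^2(x^1,x^2,x^3)&=-c_1F_1(x^1)-\lambda F_2(x^2)+c_4x^3+c_5,\\ V^3(x^1,x^2,x^3)&=-c_2F_1(x^1)-c_4F_2(x^2)-(\lambda+\mu)x^3+c_6, \end{aligned}$$ where $F_i$ is an antiderivative of $\frac{1}{f_i}$ for $i\in\{1,2\}$.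
   Context: Let $I=I_1\times I_2\times I_3\subseteq\mathbb R^3$ with $I_1,I_2,I_3\subseteq\mathbb R$ open intervals and standard coordinates $x^1,x^2,x^3$. Let $f_1,f_2$ be smooth nowhere zero functions on $I$ and endow $I$ with the Riemannian metric $\tilde g=\frac{1}{f_1^2}dx^1\otimes dx^1+\frac{1}{f_2^2}dx^2\otimes dx^2+dx^3\otimes dx^3$. Let $E_1=f_1\frac{\partial}{\partial x^1}$, $E_2=f_2\frac{\partial}{\partial x^2}$, $E_3=\frac{\partial}{\partial x^3}$ (an orthonormal frame). For a smooth vector field $V$ on $I$, a $1$-form $\eta$ on $I$, and real constants $\lambda,\mu$ with $\mu\neq0$, $(I,\tilde g,V,\lambda,\mu)$ is an $\eta$-Ricci soliton if $\frac12\pounds_V\tilde g+\mathrm{Ric}+\lambda\tilde g+\mu\,\eta\otimes\eta=0$ on $I$, where $\pounds_V\tilde g$ is the Lie derivative of $\tilde g$ along $V$ and $\mathrm{Ric}$ is the Ricci tensor of $\tilde g$, with $\mathrm{Ric}(Y,Z)=\sum_{k}\tilde g(R(E_k,Y)Z,E_k)$, $R(X,Y)Z=\nabla_X\nabla_YZ-\nabla_Y\nabla_XZ-\nabla_{[X,Y]}Z$, $\nabla$ the Levi-Civita connection. *)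

theory Defs
  imports "HOL-Analysis.Analysis"
begin

text \<open>Vector fields on an open set \<open>S\<close> of a Euclidean space are represented by their standard
  coordinates, i.e. as functions \<open>'a \<Rightarrow> 'a\<close>; 1-forms and bilinear tensor fields are functions
  \<open>'a \<Rightarrow> 'a \<Rightarrow> real\<close> and \<open>'a \<Rightarrow> 'a \<Rightarrow> 'a \<Rightarrow> real\<close> whose first argument is the base point. Functions
  are total, so only their values on \<open>S\<close> are ever constrained.\<close>

text \<open>The iterated directional derivatives below determine the class \<open>C\<^sup>n\<close> only when \<open>S\<close> is open,
  because \<open>frechet_derivative\<close> is taken in the ambient space.\<close>

primrec Ck_on :: "'a::euclidean_space set \<Rightarrow> nat \<Rightarrow> ('a \<Rightarrow> 'b::real_normed_vector) \<Rightarrow> bool" where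
  "Ck_on S 0 f \<longleftrightarrow> continuous_on S f"
| "Ck_on S (Suc n) f \<longleftrightarrow> (\<forall>x\<in>S. f differentiable (at x)) \<and>
     (\<forall>v. Ck_on S n (\<lambda>x. frechet_derivative f (at x) v))"

definition smooth_on :: "'a::euclidean_space set \<Rightarrow> ('a \<Rightarrow> 'b::real_normed_vector) \<Rightarrow> bool" where
  "smooth_on S f \<longleftrightarrow> (\<forall>n. Ck_on S n f)"

definition vf_apply ::
    "('a::euclidean_space \<Rightarrow> 'a) \<Rightarrow> ('a \<Rightarrow> 'b::real_normed_vector) \<Rightarrow> 'a \<Rightarrow> 'b" where
  "vf_apply X h x = frechet_derivative h (at x) (X x)"

text \<open>In coordinates, \<open>[X,Y]\<^sup>k = X(Y\<^sup>k) - Y(X\<^sup>k)\<close>.\<close>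

definition lie_bracket ::
    "('a::euclidean_space \<Rightarrow> 'a) \<Rightarrow> ('a \<Rightarrow> 'a) \<Rightarrow> 'a \<Rightarrow> 'a" where
  "lie_bracket X Y x = vf_apply X Y x - vf_apply Y X x"

definition affine_connection_on ::
    "'a::euclidean_space set \<Rightarrow> (('a \<Rightarrow> 'a) \<Rightarrow> ('a \<Rightarrow> 'a) \<Rightarrow> 'a \<Rightarrow> 'a) \<Rightarrow> bool" where
  "affine_connection_on S D \<longleftrightarrow>
     (\<forall>X Y. smooth_on S X \<longrightarrow> smooth_on S Y \<longrightarrow> smooth_on S (D X Y)) \<and>
     (\<forall>X X' Y. smooth_on S X \<longrightarrow> smooth_on S X' \<longrightarrow> smooth_on S Y \<longrightarrow>
        (\<forall>x\<in>S. D (\<lambda>y. X y + X' y) Y x = D X Y x + D X' Y x)) \<and>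
     (\<forall>h X Y. smooth_on S h \<longrightarrow> smooth_on S X \<longrightarrow> smooth_on S Y \<longrightarrow>
        (\<forall>x\<in>S. D (\<lambda>y. h y *\<^sub>R X y) Y x = h x *\<^sub>R D X Y x)) \<and>
     (\<forall>X Y Y'. smooth_on S X \<longrightarrow> smooth_on S Y \<longrightarrow> smooth_on S Y' \<longrightarrow>
        (\<forall>x\<in>S. D X (\<lambda>y. Y y + Y' y) x = D X Y x + D X Y' x)) \<and>
     (\<forall>h X Y. smooth_on S h \<longrightarrow> smooth_on S X \<longrightarrow> smooth_on S Y \<longrightarrow>
        (\<forall>x\<in>S. D X (\<lambda>y. h y *\<^sub>R Y y) x = h x *\<^sub>R D X Y x + vf_apply X h x *\<^sub>R Y x))"

definition levi_civita_on ::
    "'a::euclidean_space set \<Rightarrow> ('a \<Rightarrow> 'a \<Rightarrow> 'a \<Rightarrow> real) \<Rightarrow>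
     (('a \<Rightarrow> 'a) \<Rightarrow> ('a \<Rightarrow> 'a) \<Rightarrow> 'a \<Rightarrow> 'a) \<Rightarrow> bool" where
  "levi_civita_on S g D \<longleftrightarrow>
     affine_connection_on S D \<and>
     (\<forall>X Y. smooth_on S X \<longrightarrow> smooth_on S Y \<longrightarrow>
        (\<forall>x\<in>S. D X Y x - D Y X x = lie_bracket X Y x)) \<and>
     (\<forall>X Y Z. smooth_on S X \<longrightarrow> smooth_on S Y \<longrightarrow> smooth_on S Z \<longrightarrow>
        (\<forall>x\<in>S. vf_apply X (\<lambda>y. g y (Y y) (Z y)) x = g x (D X Y x) (Z x) + g x (Y x) (D X Z x)))"

definition riemann_curvature ::
    "(('a::euclidean_space \<Rightarrow> 'a) \<Rightarrow> ('a \<Rightarrow> 'a) \<Rightarrow> 'a \<Rightarrow> 'a) \<Rightarrow>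
     ('a \<Rightarrow> 'a) \<Rightarrow> ('a \<Rightarrow> 'a) \<Rightarrow> ('a \<Rightarrow> 'a) \<Rightarrow> 'a \<Rightarrow> 'a" where
  "riemann_curvature D X Y Z x = D X (D Y Z) x - D Y (D X Z) x - D (lie_bracket X Y) Z x"

text \<open>The trace is taken over a frame \<open>E\<close>, which is meant to be orthonormal for \<open>g\<close>.\<close>

definition ricci ::
    "('a::euclidean_space \<Rightarrow> 'a \<Rightarrow> 'a \<Rightarrow> real) \<Rightarrow> ('i::finite \<Rightarrow> 'a \<Rightarrow> 'a) \<Rightarrow>
     (('a \<Rightarrow> 'a) \<Rightarrow> ('a \<Rightarrow> 'a) \<Rightarrow> 'a \<Rightarrow> 'a) \<Rightarrow> ('a \<Rightarrow> 'a) \<Rightarrow> ('a \<Rightarrow> 'a) \<Rightarrow> 'a \<Rightarrow> real" where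
  "ricci g E D Y Z x = (\<Sum>k\<in>UNIV. g x (riemann_curvature D (E k) Y Z x) (E k x))"

definition lie_derivative_metric ::
    "('a::euclidean_space \<Rightarrow> 'a) \<Rightarrow> ('a \<Rightarrow> 'a \<Rightarrow> 'a \<Rightarrow> real) \<Rightarrow>
     ('a \<Rightarrow> 'a) \<Rightarrow> ('a \<Rightarrow> 'a) \<Rightarrow> 'a \<Rightarrow> real" where
  "lie_derivative_metric V g Y Z x =
     vf_apply V (\<lambda>y. g y (Y y) (Z y)) x
     - g x (lie_bracket V Y x) (Z x) - g x (Y x) (lie_bracket V Z x)"

definition eta_ricci_soliton_on ::
    "'a::euclidean_space set \<Rightarrow> ('a \<Rightarrow> 'a \<Rightarrow> 'a \<Rightarrow> real) \<Rightarrow> ('i::finite \<Rightarrow> 'a \<Rightarrow> 'a) \<Rightarrow>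
     (('a \<Rightarrow> 'a) \<Rightarrow> ('a \<Rightarrow> 'a) \<Rightarrow> 'a \<Rightarrow> 'a) \<Rightarrow> ('a \<Rightarrow> 'a \<Rightarrow> real) \<Rightarrow>
     ('a \<Rightarrow> 'a) \<Rightarrow> real \<Rightarrow> real \<Rightarrow> bool" where
  "eta_ricci_soliton_on S g E D \<eta> V lam mu \<longleftrightarrow>
     (\<forall>Y Z. smooth_on S Y \<longrightarrow> smooth_on S Z \<longrightarrow>
        (\<forall>x\<in>S. 1 / 2 * lie_derivative_metric V g Y Z x + ricci g E D Y Z x
               + lam * g x (Y x) (Z x) + mu * (\<eta> x (Y x) * \<eta> x (Z x)) = 0))"

definition box3 :: "real set \<Rightarrow> real set \<Rightarrow> real set \<Rightarrow> (real ^ 3) set" where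
  "box3 I1 I2 I3 = {x. x $ 1 \<in> I1 \<and> x $ 2 \<in> I2 \<and> x $ 3 \<in> I3}"

definition gtilde ::
    "(real ^ 3 \<Rightarrow> real) \<Rightarrow> (real ^ 3 \<Rightarrow> real) \<Rightarrow> real ^ 3 \<Rightarrow> real ^ 3 \<Rightarrow> real ^ 3 \<Rightarrow> real" where
  "gtilde f1 f2 x u v =
     1 / (f1 x)\<^sup>2 * (u $ 1 * v $ 1) + 1 / (f2 x)\<^sup>2 * (u $ 2 * v $ 2) + u $ 3 * v $ 3"

definition frame ::
    "(real ^ 3 \<Rightarrow> real) \<Rightarrow> (real ^ 3 \<Rightarrow> real) \<Rightarrow> 3 \<Rightarrow> real ^ 3 \<Rightarrow> real ^ 3" where
  "frame f1 f2 k x =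
     (if k = 1 then f1 x *\<^sub>R axis 1 1 else if k = 2 then f2 x *\<^sub>R axis 2 1 else axis 3 1)"

definition dx :: "3 \<Rightarrow> real ^ 3 \<Rightarrow> real ^ 3 \<Rightarrow> real" where
  "dx k x v = v $ k"

definition depends_only_on :: "3 \<Rightarrow> (real ^ 3) set \<Rightarrow> (real ^ 3 \<Rightarrow> real) \<Rightarrow> bool" where
  "depends_only_on k S f \<longleftrightarrow> (\<forall>x\<in>S. \<forall>y\<in>S. x $ k = y $ k \<longrightarrow> f x = f y)"

end

(* The frame E_k commutes and is orthonormal, so its Christoffel symbols are symmetric in the first
   and skew in the last two indices, hence zero; the metric is flat and the soliton equation on the
   frame becomes E_i V^j + E_j V^i = const. The coordinates F_1, F_2, x^3 are Euclidean for the
   metric, and there the system is, up to a diagonal part, the Killing equation, whose solutions are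
   affine with skew linear part. The integration uses first derivatives only. *)
theory Submission
  imports Defs
begin

section \<open>Locality and closure properties of the classes \<open>Ck_on\<close>\<close>

lemma frechet_derivative_cong_open:
  fixes f g :: "'a::real_normed_vector \<Rightarrow> 'b::real_normed_vector"
  assumes "open S" "x \<in> S" "\<And>y. y \<in> S \<Longrightarrow> f y = g y"
  shows "frechet_derivative f (at x) = frechet_derivative g (at x)"
proof -
  have "(f has_derivative F) (at x) \<longleftrightarrow> (g has_derivative F) (at x)" for F
    using has_derivative_transform_within_open[OF _ assms(1,2)] assms(3) by metis
  then show ?thesis by (simp add: frechet_derivative_def)
qed

text \<open>Equality on the open set \<open>S\<close> passes to all directional derivatives there,
  so the induction can continue with the derivatives in place of \<open>f\<close> and
  \<open>g\<close>.\<close>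

lemma Ck_on_cong:
  assumes "open S" "\<And>y. y \<in> S \<Longrightarrow> f y = g y" "Ck_on S n f"
  shows "Ck_on S n g"
  using assms(2,3)
proof (induction n arbitrary: f g)
  case 0
  then show ?case by (simp cong: continuous_on_cong)
next
  case (Suc n)
  have "g differentiable (at x)" if x: "x \<in> S" for x
  proof -
    obtain F where "(f has_derivative F) (at x)"
      using Suc.prems(2) x by (auto simp: differentiable_def)
    then have "(g has_derivative F) (at x)"
      using has_derivative_transform_within_open[OF _ assms(1) x] Suc.prems(1) by blast
    then show ?thesis by (auto simp: differentiable_def)
  qed
  moreover have "Ck_on S n (\<lambda>x. frechet_derivative g (at x) v)" for v
  proof (rule Suc.IH)
    show "Ck_on S n (\<lambda>x. frechet_derivative f (at x) v)"
      using Suc.prems(2) by simp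
    show "frechet_derivative f (at y) v = frechet_derivative g (at y) v" if "y \<in> S" for y
      using frechet_derivative_cong_open[OF assms(1) that] Suc.prems(1) by metis
  qed
  ultimately show ?case by simp
qed

lemma Ck_on_const: "Ck_on S n (\<lambda>x. c)"
proof (induction n arbitrary: c)
  case (Suc n)
  have "frechet_derivative (\<lambda>x. c) (at y) = (\<lambda>h. 0)" for y :: 'a
    by (rule frechet_derivative_at[symmetric]) simp
  then show ?case using Suc by simp
qed simp

text \<open>Differentiating \<open>L \<circ> f\<close> gives \<open>L\<close> applied to a
  derivative of \<open>f\<close>, which has the same shape again. The frame fields, a scalar
  function times a fixed vector, are smooth by this.\<close>

lemma Ck_on_bounded_linear:
  assumes "open S" "bounded_linear L" "Ck_on S n f"
  shows "Ck_on S n (\<lambda>x. L (f x))"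
  using assms(3)
proof (induction n arbitrary: f)
  case 0
  then show ?case using bounded_linear.continuous_on[OF assms(2)] by auto
next
  case (Suc n)
  have der: "((\<lambda>y. L (f y)) has_derivative (\<lambda>h. L (frechet_derivative f (at x) h))) (at x)"
    if "x \<in> S" for x
    using Suc.prems that
    by (intro bounded_linear.has_derivative[OF assms(2)]) (simp add: frechet_derivative_works)
  have "Ck_on S n (\<lambda>x. frechet_derivative (\<lambda>y. L (f y)) (at x) v)" for v
  proof (rule Ck_on_cong[OF assms(1)])
    show "Ck_on S n (\<lambda>x. L (frechet_derivative f (at x) v))"
      by (rule Suc.IH) (use Suc.prems in simp)
    show "L (frechet_derivative f (at y) v) = frechet_derivative (\<lambda>y. L (f y)) (at y) v"
      if "y \<in> S" for y
      using frechet_derivative_at[OF der[OF that]] by metis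
  qed
  moreover have "(\<lambda>y. L (f y)) differentiable (at x)" if "x \<in> S" for x
    using der[OF that] by (auto simp: differentiable_def)
  ultimately show ?case by simp
qed

lemma smooth_on_imp_differentiable:
  "smooth_on S f \<Longrightarrow> x \<in> S \<Longrightarrow> f differentiable (at x)"
  unfolding smooth_on_def by (metis Ck_on.simps(2))

text \<open>Brackets and covariant derivatives are known to vanish only on \<open>S\<close>, not as
  total functions; this makes them admissible arguments of the connection axioms.\<close>

lemma smooth_on_eq_zero:
  assumes "open S" "\<And>x. x \<in> S \<Longrightarrow> f x = 0"
  shows "smooth_on S f"
  unfolding smooth_on_def
  using Ck_on_cong[OF assms(1), of "\<lambda>x. 0" f] Ck_on_const assms(2) by metis

section \<open>Product metrics with their rescaled coordinate frames\<close>

text \<open>Assumption \<open>separated\<close> says infinitesimally that \<open>\<phi> k\<close> depends on the \<open>k\<close>-th coordinate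
  only.\<close>

locale product_frame =
  fixes S :: "(real ^ 'n) set" and \<phi> :: "'n \<Rightarrow> real ^ 'n \<Rightarrow> real"
  assumes open_S: "open S"
    and smooth_\<phi>: "smooth_on S (\<phi> k)"
    and \<phi>_nonzero: "x \<in> S \<Longrightarrow> \<phi> k x \<noteq> 0"
    and separated: "x \<in> S \<Longrightarrow> j \<noteq> k \<Longrightarrow> frechet_derivative (\<phi> k) (at x) (axis j 1) = 0"
begin

definition g :: "real ^ 'n \<Rightarrow> real ^ 'n \<Rightarrow> real ^ 'n \<Rightarrow> real" where
  "g x u v = (\<Sum>k\<in>UNIV. u $ k * v $ k / (\<phi> k x)\<^sup>2)"

definition E :: "'n \<Rightarrow> real ^ 'n \<Rightarrow> real ^ 'n" where
  "E k x = \<phi> k x *\<^sub>R axis k 1"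

definition d\<phi> :: "'n \<Rightarrow> real ^ 'n \<Rightarrow> real" where
  "d\<phi> k x = frechet_derivative (\<phi> k) (at x) (axis k 1)"

lemma E_nth: "E k x $ j = (if j = k then \<phi> k x else 0)"
  by (simp add: E_def axis_def)

lemma g_E_right: "x \<in> S \<Longrightarrow> g x u (E j x) = u $ j / \<phi> j x"
  using \<phi>_nonzero[of x j]
  by (simp add: g_def E_nth if_distrib if_distribR cong: if_cong) (simp add: power2_eq_square)

lemma g_commute: "g x u v = g x v u"
  by (simp add: g_def mult.commute)

lemma g_E_E: "x \<in> S \<Longrightarrow> g x (E i x) (E j x) = (if i = j then 1 else 0)"
  using \<phi>_nonzero[of x j] by (simp add: g_E_right E_nth)

lemma g_zero: "g x 0 v = 0" "g x v 0 = 0"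
  by (simp_all add: g_def)

text \<open>Nondegeneracy tested on the frame: it turns scalar identities from metric compatibility
  into vector identities.\<close>

lemma eq_zero_if_g_E_zero:
  assumes "x \<in> S" "\<And>j. g x u (E j x) = 0"
  shows "u = 0"
  using assms \<phi>_nonzero[OF assms(1)] by (simp add: g_E_right vec_eq_iff)

lemma smooth_E: "smooth_on S (E k)"
proof -
  have "bounded_linear (\<lambda>r::real. r *\<^sub>R (axis k 1 :: real ^ 'n))"
    by (rule bounded_linear_scaleR_left)
  then show ?thesis
    using smooth_\<phi>[of k] Ck_on_bounded_linear[OF open_S]
    unfolding smooth_on_def E_def by blast
qed

text \<open>Expand \<open>h\<close> in the standard basis; \<open>separated\<close> kills every
  partial derivative except the \<open>k\<close>-th.\<close>

lemma has_derivative_\<phi>: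
  assumes "x \<in> S"
  shows "(\<phi> k has_derivative (\<lambda>h. h $ k * d\<phi> k x)) (at x)"
proof -
  let ?L = "frechet_derivative (\<phi> k) (at x)"
  have D: "(\<phi> k has_derivative ?L) (at x)"
    using smooth_on_imp_differentiable[OF smooth_\<phi> assms] frechet_derivative_works by blast
  then have lin: "linear ?L"
    using has_derivative_bounded_linear bounded_linear.linear by blast
  have "?L h = h $ k * d\<phi> k x" for h
  proof -
    have "?L h = ?L (\<Sum>j\<in>UNIV. h $ j *\<^sub>R axis j 1)"
      using basis_expansion[of h] by (simp add: scalar_mult_eq_scaleR)
    also have "\<dots> = (\<Sum>j\<in>UNIV. h $ j * ?L (axis j 1))"
      by (simp add: linear_sum[OF lin] linear_scale[OF lin])
    also have "\<dots> = (\<Sum>j\<in>UNIV. if j = k then h $ k * d\<phi> k x else 0)"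
      by (rule sum.cong) (auto simp: separated[OF assms] d\<phi>_def)
    finally show ?thesis by simp
  qed
  then have "?L = (\<lambda>h. h $ k * d\<phi> k x)" by (rule ext)
  then show ?thesis using D by metis
qed

lemma has_derivative_E:
  assumes "x \<in> S"
  shows "(E k has_derivative (\<lambda>h. (h $ k * d\<phi> k x) *\<^sub>R axis k 1)) (at x)"
  unfolding E_def by (rule has_derivative_scaleR_left[OF has_derivative_\<phi>[OF assms]])

lemma vf_apply_E: "x \<in> S \<Longrightarrow> vf_apply X (E k) x = (X x $ k * d\<phi> k x) *\<^sub>R axis k 1"
  unfolding vf_apply_def by (simp add: frechet_derivative_at[OF has_derivative_E, symmetric])

lemma vf_apply_eq_const:
  assumes "x \<in> S" "\<And>y. y \<in> S \<Longrightarrow> h y = c"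
  shows "vf_apply X h x = 0"
proof -
  have "frechet_derivative h (at x) = frechet_derivative (\<lambda>y. c) (at x)"
    by (rule frechet_derivative_cong_open[OF open_S assms(1)]) (rule assms(2))
  also have "\<dots> = (\<lambda>h. 0)"
    by (rule frechet_derivative_at[symmetric]) simp
  finally show ?thesis by (simp add: vf_apply_def)
qed

text \<open>For \<open>i \<noteq> j\<close> neither scaling function varies along the other field;
  for \<open>i = j\<close> the two terms cancel.\<close>

lemma lie_bracket_E_E: "x \<in> S \<Longrightarrow> lie_bracket (E i) (E j) x = 0"
  by (cases "i = j") (auto simp: lie_bracket_def vf_apply_E E_nth)

lemma vf_apply_combination:
  assumes x: "x \<in> S"
    and V: "\<And>y. y \<in> S \<Longrightarrow> V y = (\<Sum>k\<in>UNIV. W k y *\<^sub>R E k y)"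
    and W: "\<And>k. W k differentiable (at x)"
  shows "vf_apply X V x =
    (\<Sum>k\<in>UNIV. W k x *\<^sub>R vf_apply X (E k) x + vf_apply X (W k) x *\<^sub>R E k x)"
proof -
  have "((\<lambda>y. \<Sum>k\<in>UNIV. W k y *\<^sub>R E k y) has_derivative
     (\<lambda>h. \<Sum>k\<in>UNIV. W k x *\<^sub>R frechet_derivative (E k) (at x) h
        + frechet_derivative (W k) (at x) h *\<^sub>R E k x)) (at x)"
    using W smooth_on_imp_differentiable[OF smooth_E x]
    by (intro has_derivative_sum has_derivative_scaleR) (simp_all add: frechet_derivative_works)
  note D = frechet_derivative_at[OF this]
  show ?thesis
    unfolding vf_apply_def
    by (subst frechet_derivative_cong_open[OF open_S x V], assumption) (simp flip: D)
qed

text \<open>On \<open>S\<close> the coefficient is the quotient of the \<open>k\<close>-th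
  coordinate of \<open>V\<close> by the nonvanishing \<open>\<phi> k\<close>, so it inherits
  differentiability from \<open>V\<close>.\<close>

lemma coefficient_differentiable:
  assumes x: "x \<in> S"
    and V: "\<And>y. y \<in> S \<Longrightarrow> V y = (\<Sum>k\<in>UNIV. W k y *\<^sub>R E k y)"
    and diff: "V differentiable (at x)"
  shows "W k differentiable (at x)"
proof -
  have eq: "V y $ k / \<phi> k y = W k y" if "y \<in> S" for y
    using \<phi>_nonzero[OF that, of k]
    by (simp add: V[OF that] E_nth if_distrib if_distribR cong: if_cong)
  obtain V' where "(V has_derivative V') (at x)"
    using diff by (auto simp: differentiable_def)
  then have "((\<lambda>y. V y $ k) has_derivative (\<lambda>h. V' h $ k)) (at x)"
    by (rule bounded_linear.has_derivative[OF bounded_linear_vec_nth])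
  then have "(\<lambda>y. V y $ k / \<phi> k y) differentiable (at x)"
    using has_derivative_\<phi>[OF x] \<phi>_nonzero[OF x]
    by (intro differentiable_divide) (auto simp: differentiable_def)
  then show ?thesis
    using has_derivative_transform_within_open[OF _ open_S x, of _ _ UNIV "W k"] eq
    unfolding differentiable_def by blast
qed

text \<open>By the Leibniz rule the bracket consists of terms \<open>W k\<close> times a bracket of
  frame fields, which vanish, and terms differentiating the coefficients.\<close>

lemma lie_bracket_combination_E:
  assumes x: "x \<in> S"
    and V: "\<And>y. y \<in> S \<Longrightarrow> V y = (\<Sum>k\<in>UNIV. W k y *\<^sub>R E k y)"
    and W: "\<And>k. W k differentiable (at x)"
  shows "lie_bracket V (E i) x = - (\<Sum>k\<in>UNIV. vf_apply (E i) (W k) x *\<^sub>R E k x)"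
proof -
  have Vi: "V x $ i = W i x * \<phi> i x"
    by (simp add: V[OF x] E_nth if_distrib if_distribR cong: if_cong)
  \<comment> \<open>The terms that differentiate the frame cancel: \<open>E i\<close> moves only the
    \<open>i\<close>-th coordinate, so just \<open>k = i\<close> contributes, and that term equals
    the derivative of \<open>E i\<close> along \<open>V\<close>.\<close>
  have "(\<Sum>k\<in>UNIV. W k x *\<^sub>R vf_apply (E i) (E k) x) = vf_apply V (E i) x"
  proof -
    have "(\<Sum>k\<in>UNIV. W k x *\<^sub>R vf_apply (E i) (E k) x) =
        (\<Sum>k\<in>UNIV. if k = i then W i x *\<^sub>R vf_apply (E i) (E i) x else 0)"
      by (rule sum.cong) (auto simp: vf_apply_E x E_nth)
    then show ?thesis by (simp add: vf_apply_E x E_nth Vi)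
  qed
  then show ?thesis
    by (simp add: lie_bracket_def vf_apply_combination[OF x V W] sum.distrib)
qed

text \<open>The frame is orthonormal, so the derivative of \<open>g\<close> on it vanishes and only
  the two bracket terms remain, each read off against the frame.\<close>

lemma lie_derivative_metric_E:
  assumes x: "x \<in> S"
    and V: "\<And>y. y \<in> S \<Longrightarrow> V y = (\<Sum>k\<in>UNIV. W k y *\<^sub>R E k y)"
    and W: "\<And>k. W k differentiable (at x)"
  shows "lie_derivative_metric V g (E i) (E j) x =
    vf_apply (E i) (W j) x + vf_apply (E j) (W i) x"
proof -
  have L: "g x (lie_bracket V (E i) x) (E j x) = - vf_apply (E i) (W j) x" for i j
    using \<phi>_nonzero[OF x]
    by (simp add: lie_bracket_combination_E[OF x V W] g_E_right[OF x] E_nth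
        if_distrib if_distribR cong: if_cong)
  have "vf_apply V (\<lambda>y. g y (E i y) (E j y)) x = 0"
    by (rule vf_apply_eq_const[OF x g_E_E])
  then show ?thesis
    by (simp add: lie_derivative_metric_def L g_commute[of x "E i x"])
qed

section \<open>Flatness: the Levi-Civita connection on the frame\<close>

context
  fixes D :: "(real ^ 'n \<Rightarrow> real ^ 'n) \<Rightarrow> (real ^ 'n \<Rightarrow> real ^ 'n) \<Rightarrow> real ^ 'n \<Rightarrow> real ^ 'n"
  assumes LC: "levi_civita_on S g D"
begin

lemma torsion_free:
  "smooth_on S X \<Longrightarrow> smooth_on S Y \<Longrightarrow> x \<in> S \<Longrightarrow> D X Y x - D Y X x = lie_bracket X Y x"
  using LC by (simp add: levi_civita_on_def)

lemma metric_compatible: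
  "smooth_on S X \<Longrightarrow> smooth_on S Y \<Longrightarrow> smooth_on S Z \<Longrightarrow> x \<in> S \<Longrightarrow>
    vf_apply X (\<lambda>y. g y (Y y) (Z y)) x = g x (D X Y x) (Z x) + g x (Y x) (D X Z x)"
  using LC by (simp add: levi_civita_on_def)

text \<open>Since \<open>N\<close> may be nonzero off \<open>S\<close>, this is a locality
  statement. Compatibility with the metric applied to \<open>N\<close> and \<open>E j\<close> leaves
  only the wanted component.\<close>

lemma D_zero_right:
  assumes X: "smooth_on S X" and N: "\<And>y. y \<in> S \<Longrightarrow> N y = 0" and x: "x \<in> S"
  shows "D X N x = 0"
proof (rule eq_zero_if_g_E_zero[OF x])
  fix j
  have "vf_apply X (\<lambda>y. g y (N y) (E j y)) x = 0"
    by (rule vf_apply_eq_const[OF x, where c = 0]) (simp add: N g_zero)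
  then show "g x (D X N x) (E j x) = 0"
    using metric_compatible[OF X smooth_on_eq_zero[OF open_S N] smooth_E x]
    by (simp add: N x g_zero)
qed

text \<open>Torsion-freeness swaps the arguments, and the bracket with a field vanishing on
  \<open>S\<close> is zero.\<close>

lemma D_zero_left:
  assumes X: "smooth_on S X" and N: "\<And>y. y \<in> S \<Longrightarrow> N y = 0" and x: "x \<in> S"
  shows "D N X x = 0"
proof -
  have "frechet_derivative X (at x) 0 = 0"
    using smooth_on_imp_differentiable[OF X x] linear_0 linear_frechet_derivative by blast
  then have "lie_bracket N X x = 0"
    using vf_apply_eq_const[OF x N] by (simp add: lie_bracket_def vf_apply_def[of N] N x)
  then show ?thesis
    using torsion_free[OF smooth_on_eq_zero[OF open_S N] X x] D_zero_right[OF X N x] by simp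
qed

text \<open>The Christoffel symbols are symmetric in the first two indices and skew in the last two.\<close>

lemma D_E_E:
  assumes x: "x \<in> S"
  shows "D (E i) (E j) x = 0"
proof (rule eq_zero_if_g_E_zero[OF x])
  fix k
  define a where "a i j k = g x (D (E i) (E j) x) (E k x)" for i j k
  have sym: "a i j k = a j i k" for i j k
    using torsion_free[OF smooth_E smooth_E x, of i j] by (simp add: a_def lie_bracket_E_E x)
  have skew: "a i j k = - a i k j" for i j k
  proof -
    have "vf_apply (E i) (\<lambda>y. g y (E j y) (E k y)) x = 0"
      by (rule vf_apply_eq_const[OF x g_E_E])
    then show ?thesis
      using metric_compatible[OF smooth_E smooth_E smooth_E x, of i j k]
      by (simp add: a_def g_commute[of x "E j x"])
  qed
  \<comment> \<open>Alternate the two symmetries: \<open>a i j k = a j i k = - a j k i = - a k j i =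
    a k i j = a i k j = - a i j k\<close>.\<close>
  have "a i j k = - a i j k"
    using sym skew by metis
  then show "g x (D (E i) (E j) x) (E k x) = 0"
    by (simp add: a_def)
qed

text \<open>Every term of the curvature on frame fields is a covariant derivative with one argument
  vanishing on \<open>S\<close>: an inner \<open>D (E i) (E j)\<close> or a bracket.\<close>

lemma ricci_E:
  assumes x: "x \<in> S"
  shows "ricci g E D (E i) (E j) x = 0"
  unfolding ricci_def riemann_curvature_def
  by (simp add: x D_zero_right[OF smooth_E D_E_E] D_zero_left[OF smooth_E lie_bracket_E_E] g_zero)

end

end

section \<open>Integration of the Killing-type system in separated variables\<close>

lemma antiderivative_unique:
  fixes f F :: "real \<Rightarrow> real"
  assumes "is_interval J" "a \<in> J" "x \<in> J"
    and f: "\<And>y. y \<in> J \<Longrightarrow> (f has_real_derivative k * g y) (at y)"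
    and F: "\<And>y. y \<in> J \<Longrightarrow> (F has_real_derivative g y) (at y)"
  shows "f x = f a + k * (F x - F a)"
proof -
  have "((\<lambda>y. f y - k * F y) has_real_derivative 0) (at y within J)" if "y \<in> J" for y
    using f[OF that] F[OF that]
    by (auto intro!: derivative_eq_intros intro: has_field_derivative_at_within)
  then obtain c where c: "\<And>y. y \<in> J \<Longrightarrow> f y - k * F y = c"
    using has_field_derivative_zero_constant[of J "\<lambda>y. f y - k * F y"] assms(1)
    by (auto simp: is_interval_convex_1)
  from c[OF assms(2)] c[OF assms(3)] show ?thesis by (simp add: algebra_simps)
qed

text \<open>Supplies points where an increment of \<open>F\<close> can be cancelled from a
  product.\<close>

lemma antiderivative_nonconstant:
  fixes F :: "real \<Rightarrow> real"
  assumes "open J" "a \<in> J"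
    and F: "(F has_real_derivative g) (at a)" and "g \<noteq> 0"
  obtains b where "b \<in> J" "F b \<noteq> F a"
proof (rule ccontr)
  assume "\<not> thesis"
  then have "\<And>b. b \<in> J \<Longrightarrow> F a = F b" using that by metis
  then have "(F has_real_derivative 0) (at a)"
    using has_field_derivative_transform_within_open[OF _ assms(1,2), of "\<lambda>_. F a" 0 F] by auto
  then show False using DERIV_unique[OF F] \<open>g \<noteq> 0\<close> by blast
qed

text \<open>Integrating the diagonal equations shows that the common mixed derivative \<open>c\<close> depends neither
  on \<open>s\<close> nor on \<open>t\<close>.\<close>

lemma skew_pair:
  fixes U W :: "real \<Rightarrow> real \<Rightarrow> real"
  assumes "open J" "is_interval J" "open K" "is_interval K"
    and a: "a \<in> J" and b: "b \<in> K"
    and F: "\<And>s. s \<in> J \<Longrightarrow> (F has_real_derivative p s) (at s)"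
    and G: "\<And>t. t \<in> K \<Longrightarrow> (G has_real_derivative q t) (at t)"
    and p: "\<And>s. s \<in> J \<Longrightarrow> p s \<noteq> 0" and q: "\<And>t. t \<in> K \<Longrightarrow> q t \<noteq> 0"
    and U1: "\<And>s t. s \<in> J \<Longrightarrow> t \<in> K \<Longrightarrow> ((\<lambda>s. U s t) has_real_derivative k * p s) (at s)"
    and W2: "\<And>s t. s \<in> J \<Longrightarrow> t \<in> K \<Longrightarrow> ((\<lambda>t. W s t) has_real_derivative l * q t) (at t)"
    and U2: "\<And>s t. s \<in> J \<Longrightarrow> t \<in> K \<Longrightarrow> ((\<lambda>t. U s t) has_real_derivative c s t * q t) (at t)"
    and W1: "\<And>s t. s \<in> J \<Longrightarrow> t \<in> K \<Longrightarrow> ((\<lambda>s. W s t) has_real_derivative - c s t * p s) (at s)"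
  shows "\<exists>m. \<forall>s\<in>J. \<forall>t\<in>K. U s t = U a b + k * (F s - F a) + m * (G t - G b) \<and>
     W s t = W a b - m * (F s - F a) + l * (G t - G b)"
\<comment> \<open>The witness for \<open>m\<close> stays open here; the last step instantiates it
  with \<open>c a b\<close>.\<close>
proof (intro exI ballI)
  have Us: "U s t = U a t + k * (F s - F a)" if "s \<in> J" "t \<in> K" for s t
    using antiderivative_unique[OF assms(2) a that(1), of "\<lambda>s. U s t"] U1 F that by blast
  have Wt: "W s t = W s b + l * (G t - G b)" if "s \<in> J" "t \<in> K" for s t
    using antiderivative_unique[OF assms(4) b that(2), of "\<lambda>t. W s t"] W2 G that by blast
  \<comment> \<open>By \<open>Us\<close>, \<open>U s t\<close> and \<open>U a t\<close> differ by a
    term constant in \<open>t\<close>, so their \<open>t\<close>-derivatives agree, and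
    \<open>q t\<close> cancels.\<close>
  have c1: "c s t = c a t" if st: "s \<in> J" "t \<in> K" for s t
  proof -
    have "((\<lambda>t. U a t + k * (F s - F a)) has_real_derivative c a t * q t) (at t)"
      using U2[OF a st(2)] by (auto intro!: derivative_eq_intros)
    then have "((\<lambda>t. U s t) has_real_derivative c a t * q t) (at t)"
      by (rule has_field_derivative_transform_within_open[OF _ assms(3) st(2)])
        (simp add: Us st)
    from DERIV_unique[OF U2[OF st] this] show ?thesis using q[OF st(2)] by simp
  qed
  have c2: "c s t = c s b" if st: "s \<in> J" "t \<in> K" for s t
  proof -
    have "((\<lambda>s. W s b + l * (G t - G b)) has_real_derivative - c s b * p s) (at s)"
      using W1[OF st(1) b] by (auto intro!: derivative_eq_intros)
    then have "((\<lambda>s. W s t) has_real_derivative - c s b * p s) (at s)"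
      by (rule has_field_derivative_transform_within_open[OF _ assms(1) st(1)])
        (metis Wt st(2))
    from DERIV_unique[OF W1[OF st] this] show ?thesis using p[OF st(1)] by simp
  qed
  have c: "c s t = c a b" if "s \<in> J" "t \<in> K" for s t
    using c1 c2 a b that by metis
  fix s t assume st: "s \<in> J" "t \<in> K"
  have "U a t = U a b + c a b * (G t - G b)"
    using antiderivative_unique[OF assms(4) b st(2), of "\<lambda>t. U a t" "c a b" q G]
      U2[OF a] G c[OF a] by fastforce
  moreover have "W s b = W a b + (- c a b) * (F s - F a)"
    using antiderivative_unique[OF assms(2) a st(1), of "\<lambda>s. W s b" "- c a b" p F]
      W1[OF _ b] F c[OF _ b] by fastforce
  ultimately show "U s t = U a b + k * (F s - F a) + c a b * (G t - G b) \<and>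
     W s t = W a b - c a b * (F s - F a) + l * (G t - G b)"
    using Us[OF st] Wt[OF st] by (simp add: algebra_simps)
qed

lemma skew_triple:
  fixes U1 U2 U3 :: "real \<Rightarrow> real \<Rightarrow> real \<Rightarrow> real"
  assumes I1: "open I1" "is_interval I1" and I2: "open I2" "is_interval I2"
    and I3: "open I3" "is_interval I3"
    and abd: "a \<in> I1" "b \<in> I2" "d \<in> I3"
    and F: "\<And>s. s \<in> I1 \<Longrightarrow> (F has_real_derivative p s) (at s)"
    and G: "\<And>t. t \<in> I2 \<Longrightarrow> (G has_real_derivative q t) (at t)"
    and H: "\<And>u. u \<in> I3 \<Longrightarrow> (H has_real_derivative r u) (at u)"
    and p: "\<And>s. s \<in> I1 \<Longrightarrow> p s \<noteq> 0" and q: "\<And>t. t \<in> I2 \<Longrightarrow> q t \<noteq> 0"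
    and r: "\<And>u. u \<in> I3 \<Longrightarrow> r u \<noteq> 0"
    and U1: "\<And>s t u. s \<in> I1 \<Longrightarrow> t \<in> I2 \<Longrightarrow> u \<in> I3 \<Longrightarrow>
        ((\<lambda>s. U1 s t u) has_real_derivative k1 * p s) (at s) \<and>
        ((\<lambda>t. U1 s t u) has_real_derivative c12 s t u * q t) (at t) \<and>
        ((\<lambda>u. U1 s t u) has_real_derivative c13 s t u * r u) (at u)"
    and U2: "\<And>s t u. s \<in> I1 \<Longrightarrow> t \<in> I2 \<Longrightarrow> u \<in> I3 \<Longrightarrow>
        ((\<lambda>s. U2 s t u) has_real_derivative - c12 s t u * p s) (at s) \<and>
        ((\<lambda>t. U2 s t u) has_real_derivative k2 * q t) (at t) \<and>
        ((\<lambda>u. U2 s t u) has_real_derivative c23 s t u * r u) (at u)"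
    and U3: "\<And>s t u. s \<in> I1 \<Longrightarrow> t \<in> I2 \<Longrightarrow> u \<in> I3 \<Longrightarrow>
        ((\<lambda>s. U3 s t u) has_real_derivative - c13 s t u * p s) (at s) \<and>
        ((\<lambda>t. U3 s t u) has_real_derivative - c23 s t u * q t) (at t) \<and>
        ((\<lambda>u. U3 s t u) has_real_derivative k3 * r u) (at u)"
  shows "\<exists>P Q R. \<forall>s\<in>I1. \<forall>t\<in>I2. \<forall>u\<in>I3.
    U1 s t u = U1 a b d + k1 * (F s - F a) + P * (G t - G b) + Q * (H u - H d) \<and>
    U2 s t u = U2 a b d - P * (F s - F a) + k2 * (G t - G b) + R * (H u - H d) \<and>
    U3 s t u = U3 a b d - Q * (F s - F a) - R * (G t - G b) + k3 * (H u - H d)"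
proof -
  have "\<forall>u\<in>I3. \<exists>m. \<forall>s\<in>I1. \<forall>t\<in>I2.
      U1 s t u = U1 a b u + k1 * (F s - F a) + m * (G t - G b) \<and>
      U2 s t u = U2 a b u - m * (F s - F a) + k2 * (G t - G b)"
    using U1 U2 by (intro ballI skew_pair[OF I1 I2 abd(1,2) F G p q]) auto
  then obtain P where P: "\<And>s t u. s \<in> I1 \<Longrightarrow> t \<in> I2 \<Longrightarrow> u \<in> I3 \<Longrightarrow>
      U1 s t u = U1 a b u + k1 * (F s - F a) + P u * (G t - G b) \<and>
      U2 s t u = U2 a b u - P u * (F s - F a) + k2 * (G t - G b)"
    by (auto dest!: bchoice)
  have "\<forall>t\<in>I2. \<exists>m. \<forall>s\<in>I1. \<forall>u\<in>I3.
      U1 s t u = U1 a t d + k1 * (F s - F a) + m * (H u - H d) \<and>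
      U3 s t u = U3 a t d - m * (F s - F a) + k3 * (H u - H d)"
    using U1 U3
    by (intro ballI skew_pair[OF I1 I3 abd(1,3) F H p r, where U = "\<lambda>s. U1 s _"]) auto
  then obtain Q where Q: "\<And>s t u. s \<in> I1 \<Longrightarrow> t \<in> I2 \<Longrightarrow> u \<in> I3 \<Longrightarrow>
      U1 s t u = U1 a t d + k1 * (F s - F a) + Q t * (H u - H d) \<and>
      U3 s t u = U3 a t d - Q t * (F s - F a) + k3 * (H u - H d)"
    by (auto dest!: bchoice)
  have "\<forall>s\<in>I1. \<exists>m. \<forall>t\<in>I2. \<forall>u\<in>I3.
      U2 s t u = U2 s b d + k2 * (G t - G b) + m * (H u - H d) \<and>
      U3 s t u = U3 s b d - m * (G t - G b) + k3 * (H u - H d)"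
    using U2 U3 by (intro ballI skew_pair[OF I2 I3 abd(2,3) G H q r]) auto
  then obtain R where R: "\<And>s t u. s \<in> I1 \<Longrightarrow> t \<in> I2 \<Longrightarrow> u \<in> I3 \<Longrightarrow>
      U2 s t u = U2 s b d + k2 * (G t - G b) + R s * (H u - H d) \<and>
      U3 s t u = U3 s b d - R s * (G t - G b) + k3 * (H u - H d)"
    by (auto dest!: bchoice)
  txt \<open>Writing \<open>P\<close>, \<open>Q\<close>, \<open>R\<close> for increments from the base point and \<open>F\<close>, \<open>G\<close>, \<open>H\<close> likewise, the
    identities \<open>P G = Q H\<close>, \<open>- P F = R H\<close>, \<open>Q F = R G\<close> give \<open>P G F = Q F H = R H G = - P G F\<close>, so
    \<open>P = 0\<close>.\<close>
  have PQ: "(P u - P d) * (G t - G b) = (Q t - Q b) * (H u - H d)"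
    if "t \<in> I2" "u \<in> I3" for t u
    using P[OF abd(1) that] P[OF abd(1) that(1) abd(3)] Q[OF abd(1) that] Q[OF abd(1,2) that(2)]
    by (simp add: algebra_simps)
  have PR: "- (P u - P d) * (F s - F a) = (R s - R a) * (H u - H d)"
    if "s \<in> I1" "u \<in> I3" for s u
    using P[OF that(1) abd(2) that(2)] P[OF that(1) abd(2,3)]
      R[OF that(1) abd(2) that(2)] R[OF abd(1,2) that(2)]
    by (simp add: algebra_simps)
  have QR: "(Q t - Q b) * (F s - F a) = (R s - R a) * (G t - G b)"
    if "s \<in> I1" "t \<in> I2" for s t
    using Q[OF that abd(3)] Q[OF that(1) abd(2,3)] R[OF that abd(3)] R[OF abd(1) that(2) abd(3)]
    by (simp add: algebra_simps)
  \<comment> \<open>Points with nonzero increments of \<open>F\<close>, \<open>G\<close>,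
    \<open>H\<close>, so that these factors can be divided out.\<close>
  obtain a' where a': "a' \<in> I1" "F a' \<noteq> F a"
    using antiderivative_nonconstant[OF I1(1) abd(1) F p] abd by blast
  obtain b' where b': "b' \<in> I2" "G b' \<noteq> G b"
    using antiderivative_nonconstant[OF I2(1) abd(2) G q] abd by blast
  obtain d' where d': "d' \<in> I3" "H d' \<noteq> H d"
    using antiderivative_nonconstant[OF I3(1) abd(3) H r] abd by blast
  have Pc: "P u = P d" if u: "u \<in> I3" for u
  proof -
    have "(P u - P d) * (G b' - G b) * (F a' - F a) =
        (Q b' - Q b) * (F a' - F a) * (H u - H d)"
      by (simp only: PQ[OF b'(1) u]) (simp add: mult_ac)
    also have "\<dots> = (R a' - R a) * (H u - H d) * (G b' - G b)"
      by (simp only: QR[OF a'(1) b'(1)]) (simp add: algebra_simps)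
    also have "\<dots> = - ((P u - P d) * (G b' - G b) * (F a' - F a))"
      by (simp only: PR[OF a'(1) u, symmetric]) (simp add: algebra_simps)
    finally show ?thesis using a' b' by simp
  qed
  have Qc: "Q t = Q b" if "t \<in> I2" for t
    using PQ[OF that d'(1)] Pc[OF d'(1)] d' by simp
  have Rc: "R s = R a" if "s \<in> I1" for s
    using PR[OF that d'(1)] Pc[OF d'(1)] d' by simp
  \<comment> \<open>\<open>P\<close> reduces \<open>U1\<close> and \<open>U2\<close> to the line
    \<open>s = a\<close>, \<open>t = b\<close>, where \<open>Q\<close> and \<open>R\<close> take
    over; for \<open>U3\<close> use \<open>R\<close> first and then \<open>Q\<close> on the line
    \<open>t = b\<close>, \<open>u = d\<close>.\<close>
  have "U1 s t u = U1 a b d + k1 * (F s - F a) + P d * (G t - G b) + Q b * (H u - H d) \<and>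
    U2 s t u = U2 a b d - P d * (F s - F a) + k2 * (G t - G b) + R a * (H u - H d) \<and>
    U3 s t u = U3 a b d - Q b * (F s - F a) - R a * (G t - G b) + k3 * (H u - H d)"
    if "s \<in> I1" "t \<in> I2" "u \<in> I3" for s t u
    using P[OF that] Q[OF abd(1,2) that(3)] R[OF abd(1,2) that(3)] R[OF that]
      Q[OF that(1) abd(2,3)] Pc[OF that(3)] Rc[OF that(1)]
    by (simp add: algebra_simps)
  then show ?thesis by blast
qed

section \<open>Restriction to coordinate lines\<close>

text \<open>Along the line through \<open>x\<close> in direction \<open>j\<close> the function is
  constant as long as the line stays in \<open>S\<close>; the chain rule at \<open>0\<close> gives
  the claim.\<close>

lemma frechet_derivative_depends_only_on:
  assumes "open S" "x \<in> S" "depends_only_on k S f" "f differentiable (at x)" "j \<noteq> k"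
  shows "frechet_derivative f (at x) (axis j 1) = 0"
proof -
  let ?l = "\<lambda>t::real. x + t *\<^sub>R axis j 1"
  let ?f' = "frechet_derivative f (at x)"
  have "(?l has_derivative (\<lambda>t. t *\<^sub>R axis j 1)) (at 0)"
    by (auto intro!: derivative_eq_intros)
  moreover have "(f has_derivative ?f') (at (?l 0))"
    using assms(4) by (simp add: frechet_derivative_works)
  ultimately have D: "((f \<circ> ?l) has_derivative (?f' \<circ> (\<lambda>t. t *\<^sub>R axis j 1))) (at 0)"
    by (rule diff_chain_at)
  have "open (?l -` S)"
    by (rule open_vimage[OF assms(1)]) (intro continuous_intros)
  moreover have "(f \<circ> ?l) t = f x" if "t \<in> ?l -` S" for t
  proof -
    have "?l t $ k = x $ k" using assms(5) by (simp add: axis_def)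
    then show ?thesis using assms(2,3) that unfolding depends_only_on_def comp_apply by blast
  qed
  ultimately have "((\<lambda>t. f x) has_derivative (?f' \<circ> (\<lambda>t. t *\<^sub>R axis j 1))) (at 0)"
    using has_derivative_transform_within_open[OF D, of "?l -` S" "\<lambda>t. f x"] assms(2) by simp
  from has_derivative_unique[OF this has_derivative_const] have "?f' (1 *\<^sub>R axis j 1) = 0"
    by (metis comp_apply)
  then show ?thesis by simp
qed

lemma vector_3_eq: "vector [x $ 1, x $ 2, x $ 3] = (x :: 'a::zero ^ 3)"
  by (simp add: vec_eq_iff forall_3)

text \<open>The line \<open>\<gamma>\<close> is parametrised by the coordinate itself, so partial
  derivatives become ordinary ones in each argument of a function of three reals.\<close>

lemma has_real_derivative_axis:
  fixes f :: "real ^ 'n \<Rightarrow> real" and \<gamma> :: "real \<Rightarrow> real ^ 'n"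
  assumes "f differentiable (at (\<gamma> s))" "\<And>r. \<gamma> r = \<gamma> s + (r - s) *\<^sub>R axis j 1"
  shows "((\<lambda>r. f (\<gamma> r)) has_real_derivative frechet_derivative f (at (\<gamma> s)) (axis j 1)) (at s)"
proof -
  let ?f' = "frechet_derivative f (at (\<gamma> s))"
  have f': "(f has_derivative ?f') (at (\<gamma> s))"
    using assms(1) by (simp add: frechet_derivative_works)
  have "((\<lambda>r. \<gamma> s + (r - s) *\<^sub>R axis j 1) has_derivative (\<lambda>r. r *\<^sub>R axis j 1)) (at s)"
    by (auto intro!: derivative_eq_intros)
  moreover have \<gamma>: "\<gamma> = (\<lambda>r. \<gamma> s + (r - s) *\<^sub>R axis j 1)"
    by (rule ext) (rule assms(2))
  ultimately have "(\<gamma> has_derivative (\<lambda>r. r *\<^sub>R axis j 1)) (at s)"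
    by (subst \<gamma>)
  from has_derivative_compose[OF this f']
  have "((\<lambda>r. f (\<gamma> r)) has_derivative (\<lambda>r. ?f' (r *\<^sub>R axis j 1))) (at s)" .
  moreover have "?f' (r *\<^sub>R axis j 1) = ?f' (axis j 1) * r" for r
    using linear_scale[OF bounded_linear.linear[OF has_derivative_bounded_linear[OF f']]]
    by (simp add: mult.commute)
  ultimately show ?thesis by (simp add: has_field_derivative_def)
qed

lemma open_box3:
  assumes "open I1" "open I2" "open I3"
  shows "open (box3 I1 I2 I3)"
proof -
  have "box3 I1 I2 I3 = (\<lambda>x. x $ 1) -` I1 \<inter> ((\<lambda>x. x $ 2) -` I2 \<inter> (\<lambda>x. x $ 3) -` I3)"
    by (auto simp: box3_def)
  then show ?thesis
    by (simp only:) (rule open_Int open_vimage_vec_nth assms)+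
qed

section \<open>Component equations of the soliton and their solution on the box\<close>

theorem theorem3p9:
  fixes I1 I2 I3 :: "real set"
    and f1 f2 :: "real ^ 3 \<Rightarrow> real"
    and nabla :: "(real ^ 3 \<Rightarrow> real ^ 3) \<Rightarrow> (real ^ 3 \<Rightarrow> real ^ 3) \<Rightarrow> real ^ 3 \<Rightarrow> real ^ 3"
    and V :: "real ^ 3 \<Rightarrow> real ^ 3"
    and Vc :: "3 \<Rightarrow> real ^ 3 \<Rightarrow> real"
    and lam mu :: real
    and F1 F2 :: "real \<Rightarrow> real"
  defines "I \<equiv> box3 I1 I2 I3"
  assumes "open I1" "is_interval I1" "open I2" "is_interval I2" "open I3" "is_interval I3"
    and "smooth_on I f1" "smooth_on I f2"
    and "\<forall>x\<in>I. f1 x \<noteq> 0" "\<forall>x\<in>I. f2 x \<noteq> 0"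
    and "levi_civita_on I (gtilde f1 f2) nabla"
    and "mu \<noteq> 0"
    and "smooth_on I V"
    and "\<forall>x\<in>I. V x = (\<Sum>k\<in>UNIV. Vc k x *\<^sub>R frame f1 f2 k x)"
    and "eta_ricci_soliton_on I (gtilde f1 f2) (frame f1 f2) nabla (dx 3) V lam mu"
    and "depends_only_on 1 I f1" "depends_only_on 2 I f2"
    and "\<forall>x\<in>I. (F1 has_real_derivative 1 / f1 x) (at (x $ 1))"
    and "\<forall>x\<in>I. (F2 has_real_derivative 1 / f2 x) (at (x $ 2))"
  shows "\<exists>c1 c2 c3 c4 c5 c6 :: real. \<forall>x\<in>I.
      Vc 1 x = - lam * F1 (x $ 1) + c1 * F2 (x $ 2) + c2 * x $ 3 + c3 \<and>
      Vc 2 x = - c1 * F1 (x $ 1) - lam * F2 (x $ 2) + c4 * x $ 3 + c5 \<and>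
      Vc 3 x = - c2 * F1 (x $ 1) - c4 * F2 (x $ 2) - (lam + mu) * x $ 3 + c6"
\<comment> \<open>A nonempty box provides the base point \<open>z\<close> of the integration; on an
  empty one the claim is vacuous.\<close>
proof (cases "I = {}")
  case False
  note I_def = assms(1)
  have open_I: "open I"
    using assms(2,4,6) by (simp add: I_def open_box3)
  \<comment> \<open>The third direction carries no scaling, hence the constant
    \<open>1\<close>.\<close>
  define \<phi> :: "3 \<Rightarrow> real ^ 3 \<Rightarrow> real"
    where "\<phi> k = (if k = 1 then f1 else if k = 2 then f2 else (\<lambda>_. 1))" for k
  interpret P: product_frame I \<phi>
  proof
    show "open I" by (rule open_I)
    show smooth: "smooth_on I (\<phi> k)" for k
      using assms(8,9) Ck_on_const by (auto simp: \<phi>_def smooth_on_def)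
    show "\<phi> k x \<noteq> 0" if "x \<in> I" for x k
      using assms(10,11) that by (auto simp: \<phi>_def)
    show "frechet_derivative (\<phi> k) (at x) (axis j 1) = 0" if "x \<in> I" "j \<noteq> k" for x j k
    proof (rule frechet_derivative_depends_only_on[OF open_I that(1) _ _ that(2)])
      have "depends_only_on k I (\<lambda>_. 1)"
        by (simp add: depends_only_on_def)
      then show "depends_only_on k I (\<phi> k)"
        using assms(17,18) by (simp add: \<phi>_def)
      show "\<phi> k differentiable (at x)"
        by (rule smooth_on_imp_differentiable[OF smooth that(1)])
    qed
  qed
  have g: "gtilde f1 f2 = P.g"
    by (intro ext) (simp add: gtilde_def P.g_def sum_3 \<phi>_def)
  have E: "frame f1 f2 = P.E"
  proof (intro ext)
    show "frame f1 f2 k x = P.E k x" for k x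
      using exhaust_3[of k] by (auto simp: frame_def P.E_def \<phi>_def)
  qed
  have V: "\<And>y. y \<in> I \<Longrightarrow> V y = (\<Sum>k\<in>UNIV. Vc k y *\<^sub>R P.E k y)"
    using assms(15) by (simp add: E)
  have Vc: "Vc k differentiable (at x)" if "x \<in> I" for k x
    by (rule P.coefficient_differentiable[OF that V smooth_on_imp_differentiable[OF assms(14) that]])
  have LC: "levi_civita_on I P.g nabla" using assms(12) by (simp add: g)
  define c where "c i j x = vf_apply (P.E i) (Vc j) x" for i j x
  \<comment> \<open>The soliton equation on \<open>E i\<close>, \<open>E j\<close>: Ricci vanishes,
    the Lie derivative contributes half of the left side, and \<open>dx 3\<close> sees only
    \<open>E 3\<close>.\<close>
  have killing: "c i j x + c j i x = (if i = j then - 2 * (lam + (if i = 3 then mu else 0)) else 0)"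
    if x: "x \<in> I" for i j x
  proof -
    have "1 / 2 * lie_derivative_metric V P.g (P.E i) (P.E j) x + ricci P.g P.E nabla (P.E i) (P.E j) x
        + lam * P.g x (P.E i x) (P.E j x) + mu * (dx 3 x (P.E i x) * dx 3 x (P.E j x)) = 0"
      using assms(16) x P.smooth_E unfolding eta_ricci_soliton_on_def g E by blast
    then show ?thesis
      using P.lie_derivative_metric_E[OF x V Vc[OF x]]
      by (simp add: P.ricci_E[OF LC x] P.g_E_E[OF x] dx_def P.E_nth c_def \<phi>_def split: if_splits)
  qed
  \<comment> \<open>\<open>P.E i\<close> is \<open>\<phi> i\<close> times the coordinate field, so
    dividing by \<open>\<phi> i\<close> recovers the partial derivative.\<close>
  have axis: "frechet_derivative (Vc j) (at x) (axis i 1) = c i j x * (1 / \<phi> i x)" if "x \<in> I" for i j x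
  proof -
    have "linear (frechet_derivative (Vc j) (at x))"
      using Vc[OF that] by (rule linear_frechet_derivative)
    then show ?thesis
      using P.\<phi>_nonzero[OF that] by (simp add: c_def vf_apply_def P.E_def linear_scale)
  qed
  obtain z where z: "z \<in> I" using False by blast
  define X :: "real \<Rightarrow> real \<Rightarrow> real \<Rightarrow> real ^ 3" where "X s t u = vector [s, t, u]" for s t u
  have X_nth: "X s t u $ 1 = s" "X s t u $ 2 = t" "X s t u $ 3 = u" for s t u
    by (simp_all add: X_def)
  have X_in: "X s t u \<in> I \<longleftrightarrow> s \<in> I1 \<and> t \<in> I2 \<and> u \<in> I3" for s t u
    by (simp add: I_def box3_def X_nth)
  have X_surj: "X (x $ 1) (x $ 2) (x $ 3) = x" for x
    by (simp add: X_def vector_3_eq)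
  define a b d where abd: "a = z $ 1" "b = z $ 2" "d = z $ 3"
  have abd_in: "a \<in> I1" "b \<in> I2" "d \<in> I3"
    using z X_in[of a b d] by (auto simp: abd X_surj)
  \<comment> \<open>Freezing the other coordinates at the base point turns \<open>1 / f1\<close> and
    \<open>1 / f2\<close> into functions of one real variable, the derivatives of \<open>F1\<close>
    and \<open>F2\<close>.\<close>
  define p where "p s = 1 / f1 (X s b d)" for s
  define q where "q t = 1 / f2 (X a t d)" for t
  have p_eq: "1 / \<phi> 1 (X s t u) = p s" and q_eq: "1 / \<phi> 2 (X s t u) = q t"
    and r_eq: "1 / \<phi> 3 (X s t u) = 1"
    if "s \<in> I1" "t \<in> I2" "u \<in> I3" for s t u
  proof -
    have "f1 (X s t u) = f1 (X s b d)"
      using assms(17) that abd_in unfolding depends_only_on_def by (metis X_in X_nth(1))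
    then show "1 / \<phi> 1 (X s t u) = p s" by (simp add: p_def \<phi>_def)
    have "f2 (X s t u) = f2 (X a t d)"
      using assms(18) that abd_in unfolding depends_only_on_def by (metis X_in X_nth(2))
    then show "1 / \<phi> 2 (X s t u) = q t" by (simp add: q_def \<phi>_def)
    show "1 / \<phi> 3 (X s t u) = 1" by (simp add: \<phi>_def)
  qed
  have D: "((\<lambda>s. Vc j (X s t u)) has_real_derivative c 1 j (X s t u) * p s) (at s) \<and>
      ((\<lambda>t. Vc j (X s t u)) has_real_derivative c 2 j (X s t u) * q t) (at t) \<and>
      ((\<lambda>u. Vc j (X s t u)) has_real_derivative c 3 j (X s t u) * 1) (at u)"
    if stu: "s \<in> I1" "t \<in> I2" "u \<in> I3" for s t u j
  proof -
    have x: "X s t u \<in> I" using stu by (simp add: X_in)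
    have "((\<lambda>s. Vc j (X s t u)) has_real_derivative
        frechet_derivative (Vc j) (at (X s t u)) (axis 1 1)) (at s)"
      by (rule has_real_derivative_axis[where \<gamma> = "\<lambda>s. X s t u"])
        (simp_all add: Vc x vec_eq_iff forall_3 X_nth axis_def)
    moreover have "((\<lambda>t. Vc j (X s t u)) has_real_derivative
        frechet_derivative (Vc j) (at (X s t u)) (axis 2 1)) (at t)"
      by (rule has_real_derivative_axis[where \<gamma> = "\<lambda>t. X s t u"])
        (simp_all add: Vc x vec_eq_iff forall_3 X_nth axis_def)
    moreover have "((\<lambda>u. Vc j (X s t u)) has_real_derivative
        frechet_derivative (Vc j) (at (X s t u)) (axis 3 1)) (at u)"
      by (rule has_real_derivative_axis[where \<gamma> = "\<lambda>u. X s t u"])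
        (simp_all add: Vc x vec_eq_iff forall_3 X_nth axis_def)
    ultimately show ?thesis
      by (simp only: axis[OF x] p_eq[OF stu] q_eq[OF stu] r_eq[OF stu])
  qed
  have diag: "c 1 1 x = - lam" "c 2 2 x = - lam" "c 3 3 x = - (lam + mu)"
    and skew: "c 1 2 x = - c 2 1 x" "c 1 3 x = - c 3 1 x" "c 2 3 x = - c 3 2 x" if "x \<in> I" for x
    using killing[OF that, of 1 1] killing[OF that, of 2 2] killing[OF that, of 3 3]
      killing[OF that, of 1 2] killing[OF that, of 1 3] killing[OF that, of 2 3] by simp_all
  have "\<exists>P Q R. \<forall>s\<in>I1. \<forall>t\<in>I2. \<forall>u\<in>I3.
    Vc 1 (X s t u) = Vc 1 (X a b d) + (- lam) * (F1 s - F1 a) + P * (F2 t - F2 b) + Q * (u - d) \<and>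
    Vc 2 (X s t u) = Vc 2 (X a b d) - P * (F1 s - F1 a) + (- lam) * (F2 t - F2 b) + R * (u - d) \<and>
    Vc 3 (X s t u) = Vc 3 (X a b d) - Q * (F1 s - F1 a) - R * (F2 t - F2 b) + (- (lam + mu)) * (u - d)"
  \<comment> \<open>The third coordinate is its own antiderivative, with \<open>r = 1\<close>. The
    off-diagonal functions are \<open>c i j\<close> with \<open>i > j\<close>; \<open>skew\<close>
    expresses those with \<open>i < j\<close> as their negatives.\<close>
  proof (rule skew_triple[OF assms(2-7) abd_in, where p = p and q = q and r = "\<lambda>_. 1"
        and H = "\<lambda>u. u" and ?c12.0 = "\<lambda>s t u. c 2 1 (X s t u)"
        and ?c13.0 = "\<lambda>s t u. c 3 1 (X s t u)" and ?c23.0 = "\<lambda>s t u. c 3 2 (X s t u)"])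
    fix s t u assume stu: "s \<in> I1" "t \<in> I2" "u \<in> I3"
    then have x: "X s t u \<in> I" by (simp add: X_in)
    show "((\<lambda>s. Vc 1 (X s t u)) has_real_derivative - lam * p s) (at s) \<and>
        ((\<lambda>t. Vc 1 (X s t u)) has_real_derivative c 2 1 (X s t u) * q t) (at t) \<and>
        ((\<lambda>u. Vc 1 (X s t u)) has_real_derivative c 3 1 (X s t u) * 1) (at u)"
      using D[OF stu, of 1] by (simp only: diag[OF x])
    show "((\<lambda>s. Vc 2 (X s t u)) has_real_derivative - c 2 1 (X s t u) * p s) (at s) \<and>
        ((\<lambda>t. Vc 2 (X s t u)) has_real_derivative - lam * q t) (at t) \<and>
        ((\<lambda>u. Vc 2 (X s t u)) has_real_derivative c 3 2 (X s t u) * 1) (at u)"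
      using D[OF stu, of 2] by (simp only: diag[OF x] skew[OF x])
    show "((\<lambda>s. Vc 3 (X s t u)) has_real_derivative - c 3 1 (X s t u) * p s) (at s) \<and>
        ((\<lambda>t. Vc 3 (X s t u)) has_real_derivative - c 3 2 (X s t u) * q t) (at t) \<and>
        ((\<lambda>u. Vc 3 (X s t u)) has_real_derivative - (lam + mu) * 1) (at u)"
      using D[OF stu, of 3] by (simp only: diag[OF x] skew[OF x])
  next
    fix s assume "s \<in> I1"
    then have "X s b d \<in> I" using abd_in by (simp add: X_in)
    then show "(F1 has_real_derivative p s) (at s)" "p s \<noteq> 0"
      using assms(10,19) X_nth(1) by (force simp: p_def)+
  next
    fix t assume "t \<in> I2"
    then have "X a t d \<in> I" using abd_in by (simp add: X_in)
    then show "(F2 has_real_derivative q t) (at t)" "q t \<noteq> 0"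
      using assms(11,20) X_nth(2) by (force simp: q_def)+
  qed simp_all
  then obtain P Q R where sol: "\<And>s t u. s \<in> I1 \<Longrightarrow> t \<in> I2 \<Longrightarrow> u \<in> I3 \<Longrightarrow>
    Vc 1 (X s t u) = Vc 1 (X a b d) + (- lam) * (F1 s - F1 a) + P * (F2 t - F2 b) + Q * (u - d) \<and>
    Vc 2 (X s t u) = Vc 2 (X a b d) - P * (F1 s - F1 a) + (- lam) * (F2 t - F2 b) + R * (u - d) \<and>
    Vc 3 (X s t u) = Vc 3 (X a b d) - Q * (F1 s - F1 a) - R * (F2 t - F2 b) + (- (lam + mu)) * (u - d)"
    by blast
  show ?thesis
  \<comment> \<open>\<open>P\<close>, \<open>Q\<close>, \<open>R\<close> serve as \<open>c1\<close>,
    \<open>c2\<close>, \<open>c4\<close>; \<open>c3\<close>, \<open>c5\<close>, \<open>c6\<close>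
    collect the values at the base point.\<close>
  proof (intro exI ballI)
    fix x assume "x \<in> I"
    then have "x $ 1 \<in> I1" "x $ 2 \<in> I2" "x $ 3 \<in> I3" by (auto simp: I_def box3_def)
    from sol[OF this] show "Vc 1 x = - lam * F1 (x $ 1) + P * F2 (x $ 2) + Q * x $ 3
          + (Vc 1 (X a b d) + lam * F1 a - P * F2 b - Q * d) \<and>
        Vc 2 x = - P * F1 (x $ 1) - lam * F2 (x $ 2) + R * x $ 3
          + (Vc 2 (X a b d) + P * F1 a + lam * F2 b - R * d) \<and>
        Vc 3 x = - Q * F1 (x $ 1) - R * F2 (x $ 2) - (lam + mu) * x $ 3
          + (Vc 3 (X a b d) + Q * F1 a + R * F2 b + (lam + mu) * d)"
      unfolding X_surj by (simp add: algebra_simps)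
  qed
qed simp

end
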